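(* Assume $\mu>0$, $K>0$, $L>0$, and that the holding cost function $h:[0,\infty)\to[0,\infty)$ satisfies the assumption stated in the context. There exist unique constants $A,B,d,D,U,u$, together with a constant $\alpha$, with $$0\le d<D<U<x_2<u$$ such that the function $g(x)=g_{A,B}(x)$, $x\in[0,\infty)$, satisfies $$\int_d^D[g(x)+k]\,dx=-K,\qquad \int_U^u[g(x)-\ell]\,dx=L,$$ $$g(d)=-k-\alpha,\qquad g(D)=-k,\qquad g(U)=g(u)=\ell,$$ $$\alpha d=0,\qquad \alpha\ge0,$$ where $x_2$ is the maximizer in the following description. Furthermore, $g$ has a local minimum (on $[0,\infty)$) at some $x_1\in[0,a]$ and a maximum at some $x_2>a$; $g$ is decreasing on $(0,x_1)$, increasing on $(x_1,x_2)$ and decreasing again on $(x_2,\infty)$.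
   Context: $\mu>0$, $\sigma>0$, $K>0$, $L>0$, $k>0$, $\ell>0$ are constants and $\lambda=2\mu/\sigma^2>0$. Assumption on $h:[0,\infty)\to[0,\infty)$: $h$ is continuous and convex; there is $a\in[0,\infty)$ such that $h$ is $C^2$ on $[0,\infty)\setminus\{a\}$ and $h(a)=0$; $h'(x)<0$ for $0\le x<a$ and $h'(x)>0$ for $x>a$. (Any condition concerning $h(x)$ with $x<0$ is dropped; the case $a=0$ is allowed, and then $x_1=0$ and the interval $(0,x_1)$ is empty.) For $A,B\in\mathbb R$ and $x\in[0,\infty)$, $$g_{A,B}(x)=A-Be^{-\lambda(x-a)}-\frac{\lambda}{\mu}\int_a^x h(y)e^{-\lambda(x-y)}\,dy.$$
   Formalization: The "maximum" of g at x_2 is taken as a local maximum on [0,∞); a global maximum is false in general, since for h(x)=(x-a)^2 with a large, g(0) exceeds g(x_2). *)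

theory Defs
  imports "HOL-Analysis.Analysis"
begin

text \<open>Functions on \<open>[0,\<infinity>)\<close> are represented by total functions of type \<open>real \<Rightarrow> real\<close>; only their
  values on \<open>{0..}\<close> are ever used.  In particular, derivatives at \<open>0\<close> are one-sided.\<close>

definition holding_cost :: "(real \<Rightarrow> real) \<Rightarrow> real \<Rightarrow> bool" where
  "holding_cost h a \<longleftrightarrow>
     (\<forall>x\<ge>0. 0 \<le> h x) \<and> continuous_on {0..} h \<and> convex_on {0..} h \<and> 0 \<le> a \<and> h a = 0 \<and>
     (\<exists>h' h''.
        (\<forall>x\<in>{0..} - {a}. (h has_real_derivative h' x) (at x within {0..})) \<and>
        (\<forall>x\<in>{0..} - {a}. (h' has_real_derivative h'' x) (at x within {0..})) \<and>
        continuous_on ({0..} - {a}) h'' \<and>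
        (\<forall>x. 0 \<le> x \<and> x < a \<longrightarrow> h' x < 0) \<and>
        (\<forall>x>a. h' x > 0))"

text \<open>For \<open>x < a\<close> the interval integral is the oriented one, i.e. minus the integral from \<open>x\<close> to \<open>a\<close>.\<close>

definition gAB ::
    "real \<Rightarrow> real \<Rightarrow> (real \<Rightarrow> real) \<Rightarrow> real \<Rightarrow> real \<Rightarrow> real \<Rightarrow> real \<Rightarrow> real" where
  "gAB \<mu> lam h a A B x =
     A - B * exp (- lam * (x - a)) - lam / \<mu> * (LBINT y=a..x. h y * exp (- lam * (x - y)))"

definition local_min_on :: "real set \<Rightarrow> (real \<Rightarrow> real) \<Rightarrow> real \<Rightarrow> bool" where
  "local_min_on S f x \<longleftrightarrow> x \<in> S \<and> (\<forall>\<^sub>F y in at x within S. f x \<le> f y)"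

definition local_max_on :: "real set \<Rightarrow> (real \<Rightarrow> real) \<Rightarrow> real \<Rightarrow> bool" where
  "local_max_on S f x \<longleftrightarrow> x \<in> S \<and> (\<forall>\<^sub>F y in at x within S. f y \<le> f x)"

text \<open>The conditions on the constants, for a given function \<open>g\<close>.  The maximum at \<open>x2\<close> is a local
  one: \<open>g\<close> decreases from \<open>g 0\<close> before its local minimum, and \<open>g 0\<close> may exceed \<open>g x2\<close>
  (for instance for \<open>h x = (x - a)\<^sup>2\<close> with \<open>a\<close> large).\<close>

definition free_boundary ::
    "real \<Rightarrow> real \<Rightarrow> real \<Rightarrow> real \<Rightarrow> (real \<Rightarrow> real) \<Rightarrow>
     real \<Rightarrow> real \<Rightarrow> real \<Rightarrow> real \<Rightarrow> real \<Rightarrow> real \<Rightarrow> bool" where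
  "free_boundary K L k l g d D U u \<alpha> x2 \<longleftrightarrow>
     0 \<le> d \<and> d < D \<and> D < U \<and> U < x2 \<and> x2 < u \<and> local_max_on {0..} g x2 \<and>
     (LBINT x=d..D. g x + k) = - K \<and>
     (LBINT x=U..u. g x - l) = L \<and>
     g d = - k - \<alpha> \<and> g D = - k \<and> g U = l \<and> g u = l \<and>
     \<alpha> * d = 0 \<and> 0 \<le> \<alpha>"

definition valley_peak_shape :: "(real \<Rightarrow> real) \<Rightarrow> real \<Rightarrow> real \<Rightarrow> real \<Rightarrow> bool" where
  "valley_peak_shape g a x1 x2 \<longleftrightarrow>
     x1 \<in> {0..a} \<and> local_min_on {0..} g x1 \<and>
     a < x2 \<and> local_max_on {0..} g x2 \<and>
     strict_antimono_on {0<..<x1} g \<and>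
     strict_mono_on {x1<..<x2} g \<and>
     strict_antimono_on {x2<..} g"

end

theory Submission
  imports Defs
begin

text \<open>Differentiating \<open>g = g\<^bsub>A,B\<^esub>\<close> and integrating by parts gives
\<open>g' x = \<lambda> e\<^bsup>-\<lambda>(x-a)\<^esup> (B - P x)\<close>, where \<open>P x = (1/\<mu>) \<integral>\<^sub>a\<^sup>x h' y e\<^bsup>\<lambda>(y-a)\<^esup> dy\<close>.
As \<open>h'\<close> changes sign from minus to plus at \<open>a\<close>, the function \<open>P\<close> falls strictly to \<open>P a = 0\<close>
and then rises strictly; it is unbounded because the convex function \<open>h\<close> is.  Hence for \<open>B > 0\<close>
the derivative of \<open>g\<close> has the signs \<open>-\<close>, \<open>+\<close>, \<open>-\<close>, changing at a valley
\<open>lo B\<close> in \<open>[0, a]\<close> and at a peak \<open>hi B > a\<close>, which depend on \<open>B\<close> only; when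
\<open>B \<ge> P 0\<close> the first phase is empty and the valley is \<open>0\<close>.  Nothing
else about \<open>P\<close> matters, apart from \<open>g\<close> tending to \<open>-\<infinity>\<close>, so the free boundary problem is solved in a locale (\<open>valley_peak\<close>) that assumes these
properties.

Uniqueness rests on the fact that for \<open>B < B'\<close> the difference \<open>g\<^bsub>A',B'\<^esub> - g\<^bsub>A,B\<^esub>\<close> is
strictly increasing.  Let both functions solve the problem, with points \<open>U\<close> and \<open>U'\<close> for the upper level.
If the difference is nonnegative at \<open>U\<close>, then it is positive to the right of \<open>U\<close>, and the hump of the
second function above \<open>l\<close> contains that of the first and is larger (\<open>upper_integral_less\<close>).
Otherwise it is negative on all of \<open>[0, U]\<close>, and the second function has the larger area below
\<open>- k\<close> (\<open>lower_integral_less\<close>).  Either way the two prescribed areas cannot both agree.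

Existence is a shooting argument.  For fixed \<open>B\<close>, raising \<open>A\<close> increases the area of the hump above \<open>l\<close>
from \<open>0\<close> to beyond every bound, so a unique \<open>A = f B\<close> makes that area equal to \<open>L\<close>, and
\<open>f\<close> is continuous.  With this choice, the area below \<open>- k\<close> to the left of the peak is a continuous
function of \<open>B\<close>.  It is \<open>0\<close> at \<open>B = 0\<close>, where the function is decreasing and still above \<open>0\<close> at
\<open>a\<close>, and it exceeds \<open>K\<close> for large \<open>B\<close>: a hump of area \<open>L\<close> two units to the right of \<open>a\<close> bounds
\<open>f B\<close> by \<open>B e\<^bsup>-2\<lambda>\<^esup>\<close> up to a constant, whereas on \<open>[a, a + 1]\<close> the term subtracted from it is at
least \<open>B e\<^bsup>-\<lambda>\<^esup>\<close>.  The intermediate value theorem yields \<open>B\<close>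
(\<open>areas_attained\<close>), and the four boundary points are then level points of \<open>g\<close>, with \<open>d = 0\<close>
if \<open>g 0 \<le> - k\<close>.\<close>

section \<open>Preliminaries on integrals, derivatives and implicit functions\<close>

lemma interval_integral_continuous_eq:
  fixes f :: "real \<Rightarrow> real"
  assumes "a \<le> b" "continuous_on {a..b} f"
  shows "(LBINT x=a..b. f x) = integral {a..b} f"
  using assms by (intro interval_integral_eq_integral borel_integrable_atLeastAtMost') auto

text \<open>The graph of the solution is the level set of \<open>\<phi>\<close>, which is closed, and a function into a compact
set with closed graph is continuous.\<close>

lemma implicit_solution_continuous:
  fixes f :: "'a::euclidean_space \<Rightarrow> 'b::euclidean_space"
    and \<phi> :: "'a \<times> 'b \<Rightarrow> 'c::t1_space"
  assumes "closed S" "compact T" and cont: "continuous_on (S \<times> T) \<phi>"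
    and sol: "\<And>x. x \<in> S \<Longrightarrow> f x \<in> T \<and> \<phi> (x, f x) = c"
    and uniq: "\<And>x y. \<lbrakk>x \<in> S; y \<in> T; \<phi> (x, y) = c\<rbrakk> \<Longrightarrow> y = f x"
  shows "continuous_on S f"
proof (rule continuous_from_closed_graph[OF \<open>compact T\<close>])
  have "(\<lambda>x. (x, f x)) ` S = {z \<in> S \<times> T. \<phi> z = c}"
    using sol uniq by auto
  also have "closed \<dots>"
    using assms(1) compact_imp_closed[OF assms(2)] cont
    by (intro continuous_closed_preimage_constant closed_Times)
  finally show "closed ((\<lambda>x. (x, f x)) ` S)" .
qed (use sol in auto)

lemma at_within_atLeast_pos: "at x within {0..} = at x" if "0 < x" for x :: real
  using that by (intro at_within_interior) (simp add: interior_real_atLeast)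

section \<open>Functions with one valley and one peak\<close>

text \<open>\<open>P x\<close> is the value of \<open>B\<close> for which \<open>g\<close> has a critical point at \<open>x\<close>, and \<open>J\<close> is the part of
\<open>- g\<close> that is independent of the two parameters.\<close>

locale valley_peak =
  fixes lam a :: real and P J :: "real \<Rightarrow> real"
  assumes lam_pos: "0 < lam" and a_nonneg: "0 \<le> a"
    and P_cont: "continuous_on {0..} P" and P_a: "P a = 0"
    and P_less_left: "\<And>x y. \<lbrakk>0 \<le> x; x < y; y \<le> a\<rbrakk> \<Longrightarrow> P y < P x"
    and P_less_right: "\<And>x y. \<lbrakk>a \<le> x; x < y\<rbrakk> \<Longrightarrow> P x < P y"
    and P_top: "filterlim P at_top at_top"
    and J_a: "J a = 0"
    and J_deriv: "\<And>x. 0 \<le> x \<Longrightarrow>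
      (J has_real_derivative lam * exp (- lam * (x - a)) * P x) (at x within {0..})"
    and J_top: "filterlim J at_top at_top"
begin

definition g :: "real \<Rightarrow> real \<Rightarrow> real \<Rightarrow> real" where
  "g A B x = A - B * exp (- lam * (x - a)) - J x"

text \<open>The valley and the peak of \<open>g A B\<close>.  The truncation at \<open>P 0\<close> puts the valley at \<open>0\<close> when
\<open>B\<close> is so large that \<open>g\<close> has no initial decreasing phase; it also keeps \<open>lo\<close> continuous in \<open>B\<close>.\<close>

definition lo :: "real \<Rightarrow> real" where
  "lo B = inv_into {0..a} P (min B (P 0))"

definition hi :: "real \<Rightarrow> real" where
  "hi B = inv_into {a..} P B"

lemma P_inj_left: "inj_on P {0..a}"
  by (intro linorder_inj_onI) (use P_less_left in force)+

lemma P_inj_right: "inj_on P {a..}"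
  by (intro linorder_inj_onI) (use P_less_right in force)+

lemma P_nonneg: "0 \<le> x \<Longrightarrow> 0 \<le> P x"
  using P_less_left[of x a] P_less_right[of a x] P_a by (cases x a rule: linorder_cases) auto

lemma P_image_left:
  assumes "0 \<le> c" "c \<le> P 0"
  shows "c \<in> P ` {0..a}"
proof -
  have "continuous_on {0..a} P" by (rule continuous_on_subset[OF P_cont]) auto
  then obtain x where "0 \<le> x" "x \<le> a" "P x = c"
    using IVT2'[of P a c 0] assms a_nonneg P_a by auto
  then show ?thesis by auto
qed

lemma P_image_right:
  assumes "0 \<le> c" "c \<le> P X" "a \<le> X"
  shows "c \<in> P ` {a..X}"
proof -
  have "continuous_on {a..X} P" by (rule continuous_on_subset[OF P_cont]) (use a_nonneg in auto)
  then obtain x where "a \<le> x" "x \<le> X" "P x = c"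
    using IVT'[of P a c X] assms P_a by auto
  then show ?thesis by auto
qed

lemma P_unbounded: "\<exists>X\<ge>a. B \<le> P X"
proof -
  have "eventually (\<lambda>x. B \<le> P x \<and> a \<le> x) at_top"
    using P_top by (intro eventually_conj eventually_ge_at_top) (simp add: filterlim_at_top)
  then show ?thesis by (auto simp: eventually_at_top_linorder)
qed

lemma lo_props:
  assumes "0 \<le> B"
  shows lo_nonneg: "0 \<le> lo B" and lo_le_a: "lo B \<le> a"
    and P_lo: "P (lo B) = min B (P 0)"
proof -
  have "min B (P 0) \<in> P ` {0..a}"
    using assms P_nonneg[of 0] by (intro P_image_left) auto
  from inv_into_into[OF this] f_inv_into_f[OF this]
  show "0 \<le> lo B" "lo B \<le> a" "P (lo B) = min B (P 0)" by (auto simp: lo_def)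
qed

lemma hi_props:
  assumes "0 \<le> B"
  shows a_le_hi: "a \<le> hi B" and P_hi: "P (hi B) = B"
proof -
  obtain X where "X \<ge> a" "B \<le> P X" using P_unbounded by blast
  then have "B \<in> P ` {a..}" using P_image_right[of B X] assms by auto
  from inv_into_into[OF this] f_inv_into_f[OF this]
  show "a \<le> hi B" "P (hi B) = B" by (auto simp: hi_def)
qed

lemma P_gt_before_lo:
  assumes "0 \<le> B" "0 \<le> x" "x < lo B"
  shows "B < P x"
proof -
  have "P (lo B) < P x" using assms lo_le_a by (intro P_less_left) auto
  moreover have "P x \<le> P 0"
    using P_less_left[of 0 x] assms lo_le_a[of B] by (cases "x = 0") auto
  ultimately show ?thesis using P_lo[OF assms(1)] by auto
qed

lemma P_less_between:
  assumes "0 \<le> B" "lo B < x" "x < hi B"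
  shows "P x < B"
proof (cases "x \<le> a")
  case True
  then have "P x < P (lo B)" using assms lo_nonneg by (intro P_less_left) auto
  then show ?thesis using P_lo[OF assms(1)] by auto
next
  case False
  then have "P x < P (hi B)" using assms by (intro P_less_right) auto
  then show ?thesis using P_hi assms by auto
qed

lemma P_gt_after_hi:
  assumes "0 \<le> B" "hi B < x"
  shows "B < P x"
  using P_less_right[OF a_le_hi[OF assms(1)] assms(2)] P_hi assms by auto

lemma lo_zero: "lo 0 = a" and hi_zero: "hi 0 = a"
proof -
  show "hi 0 = a"
    using inj_onD[OF P_inj_right, of "hi 0" a] hi_props[of 0] P_a by auto
  show "lo 0 = a"
    using inj_onD[OF P_inj_left, of "lo 0" a] lo_props[of 0] P_a P_nonneg[of 0] a_nonneg by auto
qed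

text \<open>A larger \<open>B\<close> widens the increasing phase on both sides, so a point of the increasing phase for \<open>B\<close>
is one for every larger parameter.  The comparison of two solutions depends on this.\<close>

lemma lo_antimono:
  assumes "0 \<le> B" "B \<le> C"
  shows "lo C \<le> lo B"
proof (rule ccontr)
  assume "\<not> lo C \<le> lo B"
  then have "P (lo C) < P (lo B)" using assms lo_props by (intro P_less_left) auto
  then show False using P_lo[of B] P_lo[of C] assms by (auto simp: min_def split: if_splits)
qed

lemma hi_mono:
  assumes "0 \<le> B" "B \<le> C"
  shows "hi B \<le> hi C"
proof (rule ccontr)
  assume "\<not> hi B \<le> hi C"
  then have "P (hi C) < P (hi B)" using assms hi_props[of C] by (intro P_less_right) auto
  then show False using P_hi assms by auto
qed

lemma g_deriv:
  assumes "0 < x"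
  shows "(g A B has_real_derivative lam * exp (- lam * (x - a)) * (B - P x)) (at x)"
proof -
  have [derivative_intros]: "(J has_real_derivative lam * exp (- lam * (x - a)) * P x) (at x)"
    using J_deriv[of x] assms by (simp add: at_within_atLeast_pos)
  show ?thesis unfolding g_def [abs_def]
    by (auto intro!: derivative_eq_intros simp: algebra_simps)
qed

lemma J_cont: "continuous_on {0..} J"
  using J_deriv by (auto intro!: DERIV_continuous_on)

lemma g_cont: "S \<subseteq> {0..} \<Longrightarrow> continuous_on S (g A B)"
  unfolding g_def [abs_def]
  by (intro continuous_intros continuous_on_subset[OF J_cont])

lemma g_decreasing_left:
  assumes "0 \<le> B" "0 \<le> x" "x < y" "y \<le> lo B"
  shows "g A B y < g A B x"
proof (rule DERIV_neg_imp_decreasing_open[OF \<open>x < y\<close>])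
  fix z assume "x < z" "z < y"
  then have "0 < z" using assms  by linarith
  moreover have "lam * exp (- lam * (z - a)) * (B - P z) < 0"
    using assms \<open>x < z\<close> \<open>z < y\<close> \<open>0 < z\<close> P_gt_before_lo[of B z] lam_pos by (intro mult_pos_neg) auto
  ultimately show "\<exists>d. DERIV (g A B) z :> d \<and> d < 0" using g_deriv by blast
qed (use assms in \<open>auto intro!: g_cont\<close>)

lemma g_increasing_middle:
  assumes "0 \<le> B" "lo B \<le> x" "x < y" "y \<le> hi B"
  shows "g A B x < g A B y"
proof (rule DERIV_pos_imp_increasing_open[OF \<open>x < y\<close>])
  fix z assume "x < z" "z < y"
  then have "0 < z" using assms lo_nonneg[of B] by linarith
  moreover have "lam * exp (- lam * (z - a)) * (B - P z) > 0"
    using assms \<open>x < z\<close> \<open>z < y\<close> \<open>0 < z\<close> P_less_between[of B z] lam_pos by (intro mult_pos_pos) auto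
  ultimately show "\<exists>d. DERIV (g A B) z :> d \<and> d > 0" using g_deriv by blast
qed (use assms lo_nonneg[of B] in \<open>auto intro!: g_cont\<close>)

lemma g_decreasing_right:
  assumes "0 \<le> B" "hi B \<le> x" "x < y"
  shows "g A B y < g A B x"
proof (rule DERIV_neg_imp_decreasing_open[OF \<open>x < y\<close>])
  fix z assume "x < z" "z < y"
  then have "0 < z" using assms a_le_hi[of B] a_nonneg by linarith
  moreover have "lam * exp (- lam * (z - a)) * (B - P z) < 0"
    using assms \<open>x < z\<close> \<open>z < y\<close> \<open>0 < z\<close> P_gt_after_hi[of B z] lam_pos by (intro mult_pos_neg) auto
  ultimately show "\<exists>d. DERIV (g A B) z :> d \<and> d < 0" using g_deriv by blast
qed (use assms a_le_hi[of B] a_nonneg in \<open>auto intro!: g_cont\<close>)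

lemma g_min_at_lo:
  assumes "0 \<le> B" "0 \<le> x" "x \<le> hi B"
  shows "g A B (lo B) \<le> g A B x"
  using g_decreasing_left[of B x "lo B" A] g_increasing_middle[of B "lo B" x A] assms
  by (cases x "lo B" rule: linorder_cases) auto

lemma g_max_at_hi:
  assumes "0 \<le> B" "lo B \<le> x"
  shows "g A B x \<le> g A B (hi B)"
  using g_increasing_middle[of B x "hi B" A] g_decreasing_right[of B "hi B" x A] assms
  by (cases x "hi B" rule: linorder_cases) auto

lemma valley_peak_shapeI:
  assumes "0 \<le> B" "lo B < hi B"
  shows "valley_peak_shape (g A B) a (lo B) (hi B)"
proof -
  have "a < hi B" using assms lo_zero hi_zero a_le_hi[of B] P_hi[of B] P_a
    by (cases "B = 0") (auto simp: order_less_le)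
  have "\<forall>\<^sub>F y in at (lo B) within {0..}. y < hi B"
    using assms(2) by (auto intro: order_tendstoD(2)[OF tendsto_ident_at])
  then have 1: "\<forall>\<^sub>F y in at (lo B) within {0..}. g A B (lo B) \<le> g A B y"
    by (auto simp: eventually_at_filter elim!: eventually_mono intro!: g_min_at_lo assms)
  have "\<forall>\<^sub>F y in at (hi B) within {0..}. lo B < y"
    using assms(2) by (auto intro: order_tendstoD(1)[OF tendsto_ident_at])
  then have 2: "\<forall>\<^sub>F y in at (hi B) within {0..}. g A B y \<le> g A B (hi B)"
    by (auto elim!: eventually_mono intro!: g_max_at_hi assms)
  show ?thesis
    unfolding valley_peak_shape_def local_min_on_def local_max_on_def
    using assms lo_props[of B] \<open>a < hi B\<close> 1 2 a_nonneg
      g_decreasing_left[of B _ _ A] g_increasing_middle[of B _ _ A] g_decreasing_right[of B _ _ A]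
    by (auto simp: monotone_on_def)
qed

section \<open>Uniqueness\<close>

text \<open>A solution is forced into the intended position.  The local maximum \<open>x2\<close> lies in the interior, so it
is critical, which excludes \<open>B < 0\<close>.  The point \<open>D\<close> lies beyond the valley, because
\<open>g d \<le> - k = g D\<close> with \<open>d < D\<close>; since \<open>D < x2\<close>, the critical point \<open>x2\<close> can then only be the peak.\<close>

lemma free_boundaryD:
  assumes fb: "free_boundary K L k l (g A B) d D U u \<alpha> x2" and kl: "0 < k" "0 < l"
  shows "0 \<le> B" "x2 = hi B" "lo B < D" "D < U" "U < hi B" "hi B < u" "0 \<le> d" "d < D"
    "g A B d \<le> - k" "0 < d \<Longrightarrow> d < lo B \<and> g A B d = - k"
    "g A B D = - k" "g A B U = l" "g A B u = l"
    "integral {d..D} (\<lambda>x. - k - g A B x) = K" "integral {U..u} (\<lambda>x. g A B x - l) = L"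
proof -
  note fb' = fb[unfolded free_boundary_def]
  show ord: "0 \<le> d" "d < D" "D < U"
    and gd: "g A B d \<le> - k" and gD: "g A B D = - k" and gU: "g A B U = l" and gu: "g A B u = l"
    using fb' by auto
  have x2: "U < x2" "x2 < u" "0 < x2" using fb' by auto
  have "eventually (\<lambda>y. g A B y \<le> g A B x2) (at x2)"
    using fb' x2 by (auto simp: local_max_on_def at_within_atLeast_pos)
  then obtain e where e: "e > 0" "\<And>y. y \<noteq> x2 \<Longrightarrow> dist y x2 < e \<Longrightarrow> g A B y \<le> g A B x2"
    by (auto simp: eventually_at)
  have "lam * exp (- lam * (x2 - a)) * (B - P x2) = 0"
    by (rule DERIV_local_max[OF g_deriv[OF x2(3)] e(1)]) (use e(2) in \<open>force simp: dist_real_def\<close>)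
  then have Px2: "P x2 = B" using lam_pos by simp
  then show B: "0 \<le> B" using P_nonneg[of x2] x2 by simp
  show lD: "lo B < D"
  proof (rule ccontr)
    assume "\<not> lo B < D"
    then have "g A B D < g A B d" using ord B by (intro g_decreasing_left) auto
    then show False using gd gD by simp
  qed
  have "a \<le> x2"
  proof (rule ccontr)
    assume "\<not> a \<le> x2"
    then have "P x2 < P (lo B)" using lD ord x2 B lo_nonneg[of B] by (intro P_less_left) auto
    then show False using P_lo[OF B] Px2 by simp
  qed
  then show hi: "x2 = hi B"
    using inj_onD[OF P_inj_right, of x2 "hi B"] P_hi[OF B] Px2 a_le_hi[OF B] by auto
  then show "U < hi B" "hi B < u" using x2 by auto
  show "d < lo B \<and> g A B d = - k" if "0 < d"
  proof -
    have gd': "g A B d = - k" using fb' that by auto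
    moreover have "d < lo B"
    proof (rule ccontr)
      assume "\<not> d < lo B"
      then have "g A B d < g A B D" using ord B x2 hi by (intro g_increasing_middle) auto
      then show False using gd' gD by simp
    qed
    ultimately show ?thesis by simp
  qed
  have c: "continuous_on S (\<lambda>x. g A B x + k)" "continuous_on S (\<lambda>x. g A B x - l)" if "S \<subseteq> {0..}" for S
    using that by (auto intro!: continuous_intros g_cont)
  have "integral {d..D} (\<lambda>x. g A B x + k) = - K"
    using fb' interval_integral_continuous_eq[of d D] c(1)[of "{d..D}"] by auto
  then show "integral {d..D} (\<lambda>x. - k - g A B x) = K"
    using integral_neg[of "{d..D}" "\<lambda>x. g A B x + k"] by (simp add: algebra_simps)
  show "integral {U..u} (\<lambda>x. g A B x - l) = L"
    using fb' interval_integral_continuous_eq[of U u] c(2)[of "{U..u}"] by auto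
qed

text \<open>If the second function is above the first one from \<open>U\<close> on, then \<open>[U, u] \<subseteq> [U', u']\<close>, so both the
interval and the integrand grow.  The hypotheses cover a larger \<open>B\<close> as well as the same \<open>B\<close>
with a larger \<open>A\<close>.\<close>

lemma upper_integral_less:
  assumes fb: "free_boundary K L k l (g A B) d D U u \<alpha> x2"
    and fb': "free_boundary K' L' k l (g A' B') d' D' U' u' \<alpha>' x2'"
    and kl: "0 < k" "0 < l" and B: "B \<le> B'"
    and U: "g A B U \<le> g A' B' U" and gr: "\<And>x. U < x \<Longrightarrow> g A B x < g A' B' x"
  shows "L < L'"
proof -
  note s = free_boundaryD[OF fb kl] note s' = free_boundaryD[OF fb' kl]
  have lh: "lo B' \<le> lo B" "hi B \<le> hi B'" using lo_antimono hi_mono s(1) B by auto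
  have UU: "U' \<le> U"
  proof (rule ccontr)
    assume "\<not> U' \<le> U"
    then have "g A' B' U < g A' B' U'"
      using s s' lh by (intro g_increasing_middle) auto
    then show False using s s' U by simp
  qed
  have uu: "u \<le> u'"
  proof (rule ccontr)
    assume "\<not> u \<le> u'"
    then have "g A' B' u < g A' B' u'" using s s' lh by (intro g_decreasing_right) auto
    then show False using s s' gr[of u] by simp
  qed
  have ge: "l \<le> g A' B' x" if "U' \<le> x" "x \<le> u'" for x
  proof (cases "x \<le> hi B'")
    case True
    then show ?thesis using that s' g_increasing_middle[of B' U' x A'] by (cases "x = U'") auto
  next
    case False
    then show ?thesis using that s' g_decreasing_right[of B' x u' A'] by (cases "x = u'") auto
  qed
  have c: "continuous_on S (\<lambda>x. g A B x - l)" if "S \<subseteq> {0..}" for A B S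
    using that by (auto intro!: continuous_intros g_cont)
  have "integral {U..u} (\<lambda>x. g A B x - l) < integral {U..u} (\<lambda>x. g A' B' x - l)"
    using s gr by (intro integral_less_real c) auto
  also have "\<dots> \<le> integral {U'..u'} (\<lambda>x. g A' B' x - l)"
    using s s' UU uu ge by (intro integral_subset_le integrable_continuous_real c) auto
  finally show ?thesis using s s' by simp
qed

text \<open>The mirror image: a function that is smaller up to \<open>U\<close> has \<open>[d, D] \<subseteq> [d', D']\<close>.  At the left end,
\<open>d < d'\<close> would make \<open>d'\<close> positive, hence \<open>g A' B' d' = - k\<close> in the decreasing phase, so that the second
function would exceed \<open>- k\<close> at \<open>d\<close>.\<close>

lemma lower_integral_less:
  assumes fb: "free_boundary K L k l (g A B) d D U u \<alpha> x2"
    and fb': "free_boundary K' L' k l (g A' B') d' D' U' u' \<alpha>' x2'"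
    and kl: "0 < k" "0 < l" and B: "B \<le> B'"
    and less: "\<And>x. x \<le> U \<Longrightarrow> g A' B' x < g A B x"
  shows "K < K'"
proof -
  note s = free_boundaryD[OF fb kl] note s' = free_boundaryD[OF fb' kl]
  have lh: "lo B' \<le> lo B" "hi B \<le> hi B'" using lo_antimono hi_mono s(1) B by auto
  have DD: "D \<le> D'"
  proof (rule ccontr)
    assume "\<not> D \<le> D'"
    then have "g A' B' D' < g A' B' D" using s s' lh by (intro g_increasing_middle) auto
    then show False using s s' less[of D] by simp
  qed
  have dd: "d' \<le> d"
  proof (rule ccontr)
    assume n: "\<not> d' \<le> d"
    then have "d' < lo B'" "g A' B' d' = - k" using s s' by auto
    moreover have "g A' B' d' < g A' B' d" using s s' n calculation by (intro g_decreasing_left) auto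
    ultimately show False using s less[of d] by simp
  qed
  have ge: "g A' B' x \<le> - k" if "d' \<le> x" "x \<le> D'" for x
  proof (cases "x \<le> lo B'")
    case True
    then show ?thesis using that s' g_decreasing_left[of B' d' x A'] by (cases "x = d'") auto
  next
    case False
    then show ?thesis using that s' g_increasing_middle[of B' x D' A'] by (cases "x = D'") auto
  qed
  have c: "continuous_on S (\<lambda>x. - k - g A B x)" if "S \<subseteq> {0..}" for A B S
    using that by (auto intro!: continuous_intros g_cont)
  have "integral {d..D} (\<lambda>x. - k - g A B x) < integral {d..D} (\<lambda>x. - k - g A' B' x)"
    using s less by (intro integral_less_real c) auto
  also have "\<dots> \<le> integral {d'..D'} (\<lambda>x. - k - g A' B' x)"
    using s s' DD dd ge by (intro integral_subset_le integrable_continuous_real c) auto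
  finally show ?thesis using s s' by simp
qed

text \<open>For \<open>B < B'\<close> the difference of the two functions is strictly increasing, and its sign at \<open>U\<close> decides
which of the two prescribed areas is violated.\<close>

lemma not_B_less:
  assumes fb: "free_boundary K L k l (g A B) d D U u \<alpha> x2"
    and fb': "free_boundary K L k l (g A' B') d' D' U' u' \<alpha>' x2'"
    and kl: "0 < k" "0 < l"
  shows "\<not> B < B'"
proof
  assume B: "B < B'"
  have mono: "g A' B' x - g A B x < g A' B' y - g A B y" if "x < y" for x y
  proof -
    have "exp (- lam * (y - a)) < exp (- lam * (x - a))" using that lam_pos by simp
    then have "(B' - B) * exp (- lam * (y - a)) < (B' - B) * exp (- lam * (x - a))"
      using B by (intro mult_strict_left_mono) auto
    then show ?thesis by (simp add: g_def algebra_simps)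
  qed
  show False
  proof (cases "g A B U \<le> g A' B' U")
    case True
    then have "L < L" using B mono[of U]
      by (intro upper_integral_less[OF fb fb' kl]) (auto simp: less_diff_eq diff_less_eq dest!: mono[of U])
    then show False by simp
  next
    case False
    have "g A' B' x < g A B x" if "x \<le> U" for x
      using that False mono[of x U] by (cases "x = U") auto
    then have "K < K" using B by (intro lower_integral_less[OF fb fb' kl]) auto
    then show False by simp
  qed
qed

lemma not_A_less:
  assumes fb: "free_boundary K L k l (g A B) d D U u \<alpha> x2"
    and fb': "free_boundary K L k l (g A' B) d' D' U' u' \<alpha>' x2'"
    and kl: "0 < k" "0 < l"
  shows "\<not> A < A'"
proof
  assume "A < A'"
  then have "L < L" by (intro upper_integral_less[OF fb fb' kl]) (auto simp: g_def)
  then show False by simp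
qed

lemma free_boundary_unique:
  assumes fb: "free_boundary K L k l (g A B) d D U u \<alpha> x2"
    and fb': "free_boundary K L k l (g A' B') d' D' U' u' \<alpha>' x2'"
    and kl: "0 < k" "0 < l"
  shows "(A', B', d', D', U', u') = (A, B, d, D, U, u)"
proof -
  have B: "B' = B" using not_B_less[OF fb fb' kl] not_B_less[OF fb' fb kl] by simp
  note fb' = fb'[unfolded B]
  have A: "A' = A" using not_A_less[OF fb fb' kl] not_A_less[OF fb' fb kl] by simp
  note fb' = fb'[unfolded A]
  note s = free_boundaryD[OF fb kl] note s' = free_boundaryD[OF fb' kl]
  have "D' = D"
    using s s' g_increasing_middle[of B D D' A] g_increasing_middle[of B D' D A]
    by (cases D D' rule: linorder_cases) auto
  moreover have "U' = U"
    using s s' g_increasing_middle[of B U U' A] g_increasing_middle[of B U' U A]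
    by (cases U U' rule: linorder_cases) auto
  moreover have "u' = u"
    using s s' g_decreasing_right[of B u u' A] g_decreasing_right[of B u' u A]
    by (cases u u' rule: linorder_cases) auto
  moreover have "d' = d"
    using s s' g_decreasing_left[of B d d' A] g_decreasing_left[of B d' d A]
    by (cases d d' rule: linorder_cases) auto
  ultimately show ?thesis using A B by simp
qed

section \<open>Areas as functions of the parameters\<close>

lemma lo_continuous: "continuous_on {0..} lo"
proof -
  have "continuous_on (P ` {0..a}) (inv_into {0..a} P)"
    by (rule continuous_on_inv) (auto intro!: continuous_on_subset[OF P_cont] simp: P_inj_left)
  then show ?thesis
    unfolding lo_def [abs_def]
    by (rule continuous_on_compose2)
      (use P_image_left P_nonneg[of 0] in \<open>auto intro!: continuous_intros\<close>)
qed

lemma hi_continuous: "continuous_on {0..b} hi"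
proof -
  obtain X where X: "X \<ge> a" "b \<le> P X" using P_unbounded by blast
  have "continuous_on (P ` {a..X}) hi"
    using a_nonneg
    by (intro continuous_on_inv)
      (auto intro!: continuous_on_subset[OF P_cont] simp: hi_def inv_into_f_f[OF P_inj_right])
  then show ?thesis
    by (rule continuous_on_subset) (use P_image_right X in auto)
qed

lemma J_mono: "a \<le> x \<Longrightarrow> x \<le> y \<Longrightarrow> J x \<le> J y"
  using g_decreasing_right[of 0 x y 0] by (cases "x = y") (auto simp: hi_zero g_def)

lemma J_nonneg: "a \<le> x \<Longrightarrow> 0 \<le> J x"
  using J_mono[of a x] J_a by simp

text \<open>The areas above \<open>l\<close> to the right of the valley and below \<open>- k\<close> to the left of the peak.  Clamping the
argument at \<open>lo B\<close> or \<open>hi B\<close>, instead of integrating up to it, keeps the interval of integration fixed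
and the integrand jointly continuous, so that continuity in the parameters is a theorem on parameter
integrals.  For a solution the clamped parts contribute nothing, because there \<open>g (lo B) < - k\<close> and
\<open>l < g (hi B)\<close>.\<close>

definition upper_area :: "real \<Rightarrow> real \<Rightarrow> real \<Rightarrow> real \<Rightarrow> real" where
  "upper_area R l A B = integral {0..R} (\<lambda>x. max 0 (g A B (max x (lo B)) - l))"

definition lower_area :: "real \<Rightarrow> real \<Rightarrow> real \<Rightarrow> real \<Rightarrow> real" where
  "lower_area R k A B = integral {0..R} (\<lambda>x. max 0 (- k - g A B (min x (hi B))))"

lemma upper_area_integrand_continuous:
  assumes "0 \<le> B" "S \<subseteq> {0..}"
  shows "continuous_on S (\<lambda>x. max 0 (g A B (max x (lo B)) - l))"
  by (intro continuous_intros continuous_on_compose2[OF g_cont[OF order_refl]])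
    (use assms in \<open>auto simp: max_def\<close>)

lemma lower_area_integrand_continuous:
  assumes "0 \<le> B" "S \<subseteq> {0..}"
  shows "continuous_on S (\<lambda>x. max 0 (- k - g A B (min x (hi B))))"
  by (intro continuous_intros continuous_on_compose2[OF g_cont[OF order_refl]])
    (use assms a_le_hi[of B] a_nonneg in \<open>auto simp: min_def\<close>)

lemma upper_area_continuous: "continuous_on ({0..} \<times> T) (\<lambda>(B, A). upper_area R l A B)"
proof -
  have lo: "continuous_on (({0..} \<times> T) \<times> {0..R}) (\<lambda>(p, x). lo (fst p))"
    unfolding case_prod_beta by (rule continuous_on_compose2[OF lo_continuous])
      (auto intro!: continuous_intros)
  have m: "continuous_on (({0..} \<times> T) \<times> {0..R}) (\<lambda>(p, x). max x (lo (fst p)))"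
    using lo unfolding case_prod_beta by (intro continuous_intros)
  have J: "continuous_on (({0..} \<times> T) \<times> {0..R}) (\<lambda>(p, x). J (max x (lo (fst p))))"
    using m unfolding case_prod_beta by (rule continuous_on_compose2[OF J_cont]) (auto simp: max_def)
  have "continuous_on (({0..} \<times> T) \<times> cbox 0 R)
      (\<lambda>(p, x). max 0 (g (snd p) (fst p) (max x (lo (fst p))) - l))"
    using lo J unfolding case_prod_beta g_def box_real by (intro continuous_intros)
  from integral_continuous_on_param[OF this] show ?thesis
    by (simp add: upper_area_def case_prod_beta)
qed

lemma lower_area_continuous: "continuous_on ({0..b} \<times> T) (\<lambda>(B, A). lower_area R k A B)"
proof -
  have hi: "continuous_on (({0..b} \<times> T) \<times> {0..R}) (\<lambda>(p, x). hi (fst p))"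
    unfolding case_prod_beta by (rule continuous_on_compose2[OF hi_continuous])
      (auto intro!: continuous_intros)
  have m: "continuous_on (({0..b} \<times> T) \<times> {0..R}) (\<lambda>(p, x). min x (hi (fst p)))"
    using hi unfolding case_prod_beta by (intro continuous_intros)
  have pos: "0 \<le> hi B" if "0 \<le> B" for B using a_le_hi[OF that] a_nonneg by simp
  have J: "continuous_on (({0..b} \<times> T) \<times> {0..R}) (\<lambda>(p, x). J (min x (hi (fst p))))"
    unfolding case_prod_beta
  proof (rule continuous_on_compose2[OF J_cont m[unfolded case_prod_beta]], rule image_subsetI)
    fix z :: "(real \<times> real) \<times> real" assume "z \<in> ({0..b} \<times> T) \<times> {0..R}"
    then have "0 \<le> snd z" "0 \<le> hi (fst (fst z))" by (auto intro!: pos)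
    then show "min (snd z) (hi (fst (fst z))) \<in> {0..}" by simp
  qed
  have "continuous_on (({0..b} \<times> T) \<times> cbox 0 R)
      (\<lambda>(p, x). max 0 (- k - g (snd p) (fst p) (min x (hi (fst p)))))"
    using hi J unfolding case_prod_beta g_def box_real by (intro continuous_intros)
  from integral_continuous_on_param[OF this] show ?thesis
    by (simp add: lower_area_def case_prod_beta)
qed

text \<open>Raising \<open>A\<close> raises the integrand strictly wherever it is positive, and it is positive somewhere
because the area is.\<close>

lemma upper_area_strict_mono:
  assumes "0 \<le> B" "0 < R" "A < A'" "0 < upper_area R l A B"
  shows "upper_area R l A B < upper_area R l A' B"
proof -
  let ?f = "\<lambda>A x. max 0 (g A B (max x (lo B)) - l)"
  have c: "continuous_on {0..R} (?f A)" for A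
    using assms by (intro upper_area_integrand_continuous) auto
  have le: "?f A x \<le> ?f A' x" for x using \<open>A < A'\<close> by (auto simp: g_def)
  have "integral {0..R} (?f A) \<noteq> 0" using assms by (simp add: upper_area_def)
  then obtain x where x: "x \<in> {0..R}" "?f A x \<noteq> 0"
    using integral_eq_0_iff[OF c \<open>0 < R\<close>] by auto
  then have "?f A' x - ?f A x \<noteq> 0" using \<open>A < A'\<close> by (auto simp: g_def max_def split: if_splits)
  moreover have "integral {0..R} (\<lambda>x. ?f A' x - ?f A x) = 0 \<longleftrightarrow> (\<forall>x\<in>{0..R}. ?f A' x - ?f A x = 0)"
    using le assms by (intro integral_eq_0_iff continuous_intros c) auto
  ultimately have "integral {0..R} (\<lambda>x. ?f A' x - ?f A x) \<noteq> 0" using x(1) by blast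
  moreover have "integral {0..R} (\<lambda>x. ?f A' x - ?f A x) = upper_area R l A' B - upper_area R l A B"
    unfolding upper_area_def by (intro integral_diff integrable_continuous_real c)
  moreover have "upper_area R l A B \<le> upper_area R l A' B"
    unfolding upper_area_def by (intro integral_le integrable_continuous_real c le)
  ultimately show ?thesis by simp
qed

text \<open>At \<open>A = l\<close> even the peak is not above \<open>l\<close>.\<close>

lemma upper_area_zero:
  assumes "0 \<le> B"
  shows "upper_area R l l B = 0"
proof -
  have "0 \<le> B * exp (- lam * (hi B - a))" using assms by simp
  then have "g l B (hi B) \<le> l" using J_nonneg[OF a_le_hi[OF assms]] by (simp add: g_def)
  then have "g l B (max x (lo B)) \<le> l" for x
    using g_max_at_hi[OF assms, of "max x (lo B)" l] by simp
  then have "max 0 (g l B (max x (lo B)) - l) = 0" for x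
    by (intro max_absorb1) simp
  then show ?thesis by (simp add: upper_area_def)
qed

text \<open>This \<open>A\<close> lifts \<open>g\<close> to at least \<open>l + L\<close> on \<open>[a + 2, a + 3]\<close>, an interval of length one.  The interval
is chosen at distance two from \<open>a\<close> so that \<open>B\<close> enters only with the factor \<open>e\<^bsup>-2\<lambda>\<^esup>\<close>, which
\<open>lower_area_large\<close> beats with \<open>e\<^bsup>-\<lambda>\<^esup>\<close>.\<close>

lemma upper_area_large:
  assumes "0 \<le> B" "0 < L" "a + 3 \<le> R"
  shows "L \<le> upper_area R l (L + l + B * exp (- 2 * lam) + J (a + 3)) B"
proof -
  let ?A = "L + l + B * exp (- 2 * lam) + J (a + 3)"
  let ?f = "\<lambda>x. max 0 (g ?A B (max x (lo B)) - l)"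
  have c: "continuous_on S ?f" if "S \<subseteq> {0..}" for S
    using assms that by (intro upper_area_integrand_continuous) auto
  have ge: "L \<le> ?f x" if x: "x \<in> {a + 2..a + 3}" for x
  proof -
    have "2 * lam \<le> lam * (x - a)" using mult_left_mono[of 2 "x - a" lam] x lam_pos by auto
    then have "B * exp (- lam * (x - a)) \<le> B * exp (- 2 * lam)"
      using assms by (intro mult_left_mono) auto
    moreover have "J x \<le> J (a + 3)" using x by (intro J_mono) auto
    moreover have "max x (lo B) = x" using x lo_le_a[of B] assms by (auto simp: max_def)
    ultimately show ?thesis by (simp add: g_def max_def)
  qed
  have "L = integral {a + 2..a + 3} (\<lambda>x. L)" by simp
  also have "\<dots> \<le> integral {a + 2..a + 3} ?f"
    using a_nonneg ge by (intro integral_le integrable_continuous_real c) auto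
  also have "\<dots> \<le> integral {0..R} ?f"
    using a_nonneg assms by (intro integral_subset_le integrable_continuous_real c) auto
  finally show ?thesis by (simp add: upper_area_def)
qed

lemma upper_area_solution:
  assumes "0 \<le> B" "0 < L" "a + 3 \<le> R"
  shows "\<exists>A. l \<le> A \<and> A \<le> L + l + B * exp (- 2 * lam) + J (a + 3) \<and> upper_area R l A B = L"
proof -
  let ?A = "L + l + B * exp (- 2 * lam) + J (a + 3)"
  have "continuous_on {l..?A} (\<lambda>A. upper_area R l A B)"
    using continuous_on_compose2[OF upper_area_continuous[of UNIV R l], of "{l..?A}" "\<lambda>A. (B, A)"] assms
    by (simp add: continuous_on_Pair image_subset_iff)
  moreover have "l \<le> ?A" using assms J_nonneg[of "a + 3"] by (simp add: add_nonneg_nonneg)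
  ultimately show ?thesis
    using IVT'[of "\<lambda>A. upper_area R l A B" l L ?A] upper_area_zero[OF assms(1)] upper_area_large[OF assms] assms(2) by auto
qed

text \<open>On \<open>[a, a + 1]\<close> the term \<open>B e\<^bsup>-\<lambda>(x-a)\<^esup>\<close> is at least \<open>B e\<^bsup>-\<lambda>\<^esup>\<close>, so there \<open>g\<close> is at
most \<open>- k - K\<close>.  The hypothesis \<open>P (a + 1) \<le> B\<close> puts this interval to the left of the peak.\<close>

lemma lower_area_large:
  assumes "0 < K" "a + 1 \<le> R" "P (a + 1) \<le> B"
    and A: "A \<le> M + B * exp (- 2 * lam)" and B: "K + M + k \<le> B * (exp (- lam) - exp (- 2 * lam))"
  shows "K \<le> lower_area R k A B"
proof -
  let ?f = "\<lambda>x. max 0 (- k - g A B (min x (hi B)))"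
  have B0: "0 \<le> B" using assms(3) P_nonneg[of "a + 1"] a_nonneg by simp
  have hi: "a + 1 \<le> hi B"
  proof (rule ccontr)
    assume "\<not> a + 1 \<le> hi B"
    then show False using P_gt_after_hi[of B "a + 1"] assms B0 by auto
  qed
  have c: "continuous_on S ?f" if "S \<subseteq> {0..}" for S
    using B0 that by (intro lower_area_integrand_continuous) auto
  have ge: "K \<le> ?f x" if x: "x \<in> {a..a + 1}" for x
  proof -
    have "lam * (x - a) \<le> lam" using mult_left_mono[of "x - a" 1 lam] x lam_pos by auto
    then have "B * exp (- lam) \<le> B * exp (- lam * (x - a))"
      using B0 by (intro mult_left_mono) auto
    moreover have "0 \<le> J x" using x by (intro J_nonneg) auto
    moreover have "min x (hi B) = x" using x hi by (auto simp: min_def)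
    ultimately show ?thesis using A B by (simp add: g_def max_def algebra_simps)
  qed
  have "K = integral {a..a + 1} (\<lambda>x. K)" by simp
  also have "\<dots> \<le> integral {a..a + 1} ?f"
    using a_nonneg ge by (intro integral_le integrable_continuous_real c) auto
  also have "\<dots> \<le> integral {0..R} ?f"
    using a_nonneg assms by (intro integral_subset_le integrable_continuous_real c) auto
  finally show ?thesis by (simp add: lower_area_def)
qed

text \<open>For \<open>B = 0\<close> valley and peak merge at \<open>a\<close>, and \<open>g\<close> is at least \<open>g a = A\<close> before it.\<close>

lemma lower_area_zero:
  assumes "0 < k" "0 \<le> A"
  shows "lower_area R k A 0 = 0"
proof -
  have "integral {0..R} (\<lambda>x. max 0 (- k - g A 0 (min x (hi 0)))) = integral {0..R} (\<lambda>x. 0)"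
  proof (rule integral_cong)
    fix x assume "x \<in> {0..R}"
    then have "g A 0 (hi 0) \<le> g A 0 (min x (hi 0))"
      using g_min_at_lo[of 0 "min x (hi 0)" A] a_nonneg by (simp add: lo_zero hi_zero)
    moreover have "g A 0 (hi 0) = A" by (simp add: hi_zero g_def J_a)
    ultimately show "max 0 (- k - g A 0 (min x (hi 0))) = 0" using assms by (simp add: max_def)
  qed
  then show ?thesis by (simp add: lower_area_def)
qed

section \<open>Existence\<close>

text \<open>The shooting argument.  The upper end \<open>b\<close> of the range of \<open>B\<close> is what \<open>lower_area_large\<close> asks for.
The truncation \<open>R\<close> is chosen uniformly for \<open>B\<close> in \<open>[0, b]\<close>: every \<open>f B\<close> is at most
\<open>M + b e\<^bsup>-2\<lambda>\<^esup>\<close>, so the hump has ended before \<open>R\<close> once \<open>J R\<close> reaches this bound.\<close>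

lemma areas_attained:
  assumes "0 < K" "0 < L" "0 < k" "0 < l"
  shows "\<exists>A B R. 0 \<le> B \<and> 0 < R \<and> hi B \<le> R \<and> g A B R < l \<and> upper_area R l A B = L \<and> lower_area R k A B = K"
proof -
  define M where "M = L + l + J (a + 3)"
  define q where "q = exp (- lam) - exp (- 2 * lam)"
  have q: "0 < q" using lam_pos by (simp add: q_def)
  define b where "b = max (P (a + 1)) ((K + M + k) / q)"
  have b0: "0 \<le> b" using P_nonneg[of "a + 1"] a_nonneg by (simp add: b_def)
  have bq: "K + M + k \<le> b * q" using q by (simp add: b_def max_def field_simps)
  let ?top = "M + b * exp (- 2 * lam)"
  have "eventually (\<lambda>x. ?top \<le> J x \<and> a + 3 \<le> x \<and> hi b \<le> x) at_top"
    using J_top by (intro eventually_conj eventually_ge_at_top) (simp add: filterlim_at_top)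
  then obtain R where R: "?top \<le> J R" "a + 3 \<le> R" "hi b \<le> R"
    by (auto simp: eventually_at_top_linorder)
  have R0: "0 < R" using R a_nonneg by simp
  have "\<forall>B\<in>{0..b}. \<exists>A. l \<le> A \<and> A \<le> M + B * exp (- 2 * lam) \<and> upper_area R l A B = L"
  proof
    fix B assume "B \<in> {0..b}"
    then have "0 \<le> B" by simp
    from upper_area_solution[OF this \<open>0 < L\<close> R(2), of l]
    show "\<exists>A. l \<le> A \<and> A \<le> M + B * exp (- 2 * lam) \<and> upper_area R l A B = L"
      by (simp only: M_def ac_simps)
  qed
  from bchoice[OF this] obtain f
    where "\<forall>B\<in>{0..b}. l \<le> f B \<and> f B \<le> M + B * exp (- 2 * lam) \<and> upper_area R l (f B) B = L"
    by (elim exE)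
  then have f: "l \<le> f B \<and> f B \<le> M + B * exp (- 2 * lam) \<and> upper_area R l (f B) B = L"
    if "0 \<le> B" "B \<le> b" for B
    using that by simp
  have top: "f B \<le> ?top" if "0 \<le> B" "B \<le> b" for B
  proof -
    have "B * exp (- 2 * lam) \<le> b * exp (- 2 * lam)" using that by (intro mult_right_mono) auto
    then show ?thesis using f[OF that] by linarith
  qed
  have "continuous_on {0..b} f"
  proof (rule implicit_solution_continuous[where T = "{l..?top}" and \<phi> = "\<lambda>(B, A). upper_area R l A B" and c = L])
    show "continuous_on ({0..b} \<times> {l..?top}) (\<lambda>(B, A). upper_area R l A B)"
      by (rule continuous_on_subset[OF upper_area_continuous[of UNIV]]) auto
    show "A = f B" if "B \<in> {0..b}" "A \<in> {l..?top}" "(\<lambda>(B, A). upper_area R l A B) (B, A) = L" for A B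
    proof -
      have "0 \<le> B" "B \<le> b" "upper_area R l A B = L" using that by auto
      moreover have "upper_area R l (f B) B = L" using f[OF calculation(1,2)] by simp
      ultimately show ?thesis
        using upper_area_strict_mono[of B R A "f B" l] upper_area_strict_mono[of B R "f B" A l] R0 \<open>0 < L\<close>
        by linarith
    qed
    show "f B \<in> {l..?top} \<and> (\<lambda>(B, A). upper_area R l A B) (B, f B) = L" if "B \<in> {0..b}" for B
      using f[of B] top[of B] that by simp
  qed auto
  then have "continuous_on {0..b} (\<lambda>B. (B, f B))" by (intro continuous_intros)
  from continuous_on_compose2[OF lower_area_continuous[of b UNIV R k] this]
  have "continuous_on {0..b} (\<lambda>B. lower_area R k (f B) B)" by auto
  moreover have "lower_area R k (f 0) 0 = 0" using f[of 0] b0 assms by (intro lower_area_zero) auto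
  moreover have "K \<le> lower_area R k (f b) b"
  proof (rule lower_area_large[where M = M])
    show "P (a + 1) \<le> b" by (simp add: b_def)
    show "f b \<le> M + b * exp (- 2 * lam)" using f[OF b0 order_refl] by simp
    show "K + M + k \<le> b * (exp (- lam) - exp (- 2 * lam))" using bq by (simp add: q_def)
  qed (use assms R in auto)
  ultimately obtain B where B: "0 \<le> B" "B \<le> b" "lower_area R k (f B) B = K"
    using IVT'[of "\<lambda>B. lower_area R k (f B) B" 0 K b] b0 assms(1) by (metis less_imp_le)
  have "B \<noteq> 0" using B(3) \<open>lower_area R k (f 0) 0 = 0\<close> \<open>0 < K\<close> by (metis less_irrefl)
  then have "0 < B * exp (- lam * (R - a))" using B by simp
  then have "g (f B) B R < l" using top[OF B(1,2)] R(1) \<open>0 < l\<close> by (simp add: g_def)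
  moreover have "hi B \<le> R" using hi_mono[OF B(1,2)] R by simp
  ultimately show ?thesis using B f[OF B(1,2)] R0
    by (intro exI[of _ "f B"] exI[of _ B] exI[of _ R]) simp
qed

text \<open>Both areas being positive, the valley is below \<open>- k\<close> and the peak above \<open>l\<close>.  So \<open>D\<close> and \<open>U\<close> exist in the
increasing phase and \<open>u\<close> in the last decreasing one, and the clamped integrands vanish outside
\<open>[d, D]\<close> and \<open>[U, u]\<close>.\<close>

lemma free_boundary_exists:
  assumes "0 < K" "0 < L" "0 < k" "0 < l"
  shows "\<exists>A B d D U u \<alpha>. free_boundary K L k l (g A B) d D U u \<alpha> (hi B) \<and>
    valley_peak_shape (g A B) a (lo B) (hi B)"
proof -
  obtain A B R where B: "0 \<le> B" and R: "0 < R" "hi B \<le> R" "g A B R < l"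
    and upper_area: "upper_area R l A B = L" and lower_area: "lower_area R k A B = K"
    using areas_attained[OF assms] by blast
  note lo = lo_props[OF B] note hi = a_le_hi[OF B]
  have c: "continuous_on S (g A B)" if "S \<subseteq> {0..}" for S using that by (rule g_cont)
  have min: "g A B (lo B) < - k"
  proof (rule ccontr)
    assume n: "\<not> g A B (lo B) < - k"
    have "integral {0..R} (\<lambda>x. max 0 (- k - g A B (min x (hi B)))) = integral {0..R} (\<lambda>x. 0)"
    proof (rule integral_cong)
      fix x assume "x \<in> {0..R}"
      then show "max 0 (- k - g A B (min x (hi B))) = 0"
        using n g_min_at_lo[of B "min x (hi B)" A] B hi a_nonneg by simp
    qed
    then show False using lower_area assms by (simp add: lower_area_def)
  qed
  have max: "l < g A B (hi B)"
  proof (rule ccontr)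
    assume n: "\<not> l < g A B (hi B)"
    have "integral {0..R} (\<lambda>x. max 0 (g A B (max x (lo B)) - l)) = integral {0..R} (\<lambda>x. 0)"
    proof (rule integral_cong)
      fix x
      show "max 0 (g A B (max x (lo B)) - l) = 0"
        using n g_max_at_hi[of B "max x (lo B)" A] B by simp
    qed
    then show False using upper_area assms by (simp add: upper_area_def)
  qed
  have "lo B \<noteq> hi B" using min max assms by auto
  then have lh: "lo B < hi B" using lo hi by simp
  obtain D where D: "lo B \<le> D" "D \<le> hi B" "g A B D = - k"
    using IVT'[of "g A B" "lo B" "- k" "hi B"] min max assms lh lo c[of "{lo B..hi B}"] by auto
  obtain U where U: "lo B \<le> U" "U \<le> hi B" "g A B U = l"
    using IVT'[of "g A B" "lo B" l "hi B"] min max assms lh lo c[of "{lo B..hi B}"] by auto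
  obtain u where u: "hi B \<le> u" "u \<le> R" "g A B u = l"
    using IVT2'[of "g A B" R l "hi B"] max R lh lo c[of "{hi B..R}"] by auto
  have ne: "lo B < D" "D < hi B" "lo B < U" "U < hi B" "hi B < u"
    using D U u min max assms by (auto simp: order_less_le)
  have DU: "D < U"
  proof (rule ccontr)
    assume "\<not> D < U"
    then show False using g_increasing_middle[of B U D A] B ne D U assms by (cases "U = D") auto
  qed
  \<comment> \<open>If \<open>g\<close> starts at or below \<open>- k\<close>, the left end is \<open>0\<close> and \<open>\<alpha> = - k - g 0\<close> takes up the slack.\<close>
  obtain d where d: "0 \<le> d" "d \<le> lo B" "g A B d \<le> - k" "0 < d \<Longrightarrow> g A B d = - k"
  proof (cases "g A B 0 \<le> - k")
    case True
    then show thesis using that[of 0] lo by auto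
  next
    case False
    then obtain d where "0 \<le> d" "d \<le> lo B" "g A B d = - k"
      using IVT2'[of "g A B" "lo B" "- k" 0] min lo c[of "{0..lo B}"] by auto
    then show thesis using that by auto
  qed
  have "K = integral {0..R} (\<lambda>x. if x \<in> {d..D} then - k - g A B x else 0)"
    unfolding lower_area[symmetric] lower_area_def
  proof (rule integral_cong)
    fix x assume x: "x \<in> {0..R}"
    consider "x < d" | "d \<le> x" "x \<le> lo B" | "lo B < x" "x \<le> D" | "D < x" by linarith
    then show "max 0 (- k - g A B (min x (hi B))) = (if x \<in> {d..D} then - k - g A B x else 0)"
    proof cases
      case 1
      then show ?thesis using g_decreasing_left[of B x d A] x d B lh by auto
    next
      case 2
      then have "g A B x \<le> g A B d" using g_decreasing_left[of B d x A] B d by (cases "x = d") auto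
      then show ?thesis using 2 d ne lh by auto
    next
      case 3
      then have "g A B x \<le> g A B D" using g_increasing_middle[of B x D A] B ne by (cases "x = D") auto
      then show ?thesis using 3 d ne D by auto
    next
      case 4
      then have "g A B D < g A B (min x (hi B))" using B ne by (intro g_increasing_middle) auto
      then show ?thesis using 4 D by auto
    qed
  qed
  also have "\<dots> = integral {d..D} (\<lambda>x. - k - g A B x)"
    using d ne R by (subst integral_restrict_Int) (simp add: Int_absorb2)
  also have "\<dots> = - integral {d..D} (\<lambda>x. g A B x + k)"
    by (subst integral_neg[symmetric]) (simp add: algebra_simps)
  also have "integral {d..D} (\<lambda>x. g A B x + k) = (LBINT x=d..D. g A B x + k)"
    using d ne by (intro interval_integral_continuous_eq[symmetric] continuous_intros c) auto
  finally have K: "(LBINT x=d..D. g A B x + k) = - K" by simp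
  have "L = integral {0..R} (\<lambda>x. if x \<in> {U..u} then g A B x - l else 0)"
    unfolding upper_area[symmetric] upper_area_def
  proof (rule integral_cong)
    fix x assume x: "x \<in> {0..R}"
    consider "x < U" | "U \<le> x" "x \<le> hi B" | "hi B < x" "x \<le> u" | "u < x" by linarith
    then show "max 0 (g A B (max x (lo B)) - l) = (if x \<in> {U..u} then g A B x - l else 0)"
    proof cases
      case 1
      then have "g A B (max x (lo B)) < g A B U" using B ne by (intro g_increasing_middle) auto
      then show ?thesis using 1 U by auto
    next
      case 2
      then have "g A B U \<le> g A B x" using g_increasing_middle[of B U x A] B ne by (cases "x = U") auto
      then show ?thesis using 2 U ne by auto
    next
      case 3
      then have "g A B u \<le> g A B x" using g_decreasing_right[of B x u A] B ne by (cases "x = u") auto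
      then show ?thesis using 3 u ne by auto
    next
      case 4
      then have "g A B x < g A B u" using B ne by (intro g_decreasing_right) auto
      then show ?thesis using 4 u ne lh by auto
    qed
  qed
  also have "\<dots> = integral {U..u} (\<lambda>x. g A B x - l)"
    using lo ne u by (subst integral_restrict_Int) (simp add: Int_absorb2)
  also have "\<dots> = (LBINT x=U..u. g A B x - l)"
    using ne lo by (intro interval_integral_continuous_eq[symmetric] continuous_intros c) auto
  finally have L: "(LBINT x=U..u. g A B x - l) = L" by simp
  have shape: "valley_peak_shape (g A B) a (lo B) (hi B)"
    using B lh by (rule valley_peak_shapeI)
  have "free_boundary K L k l (g A B) d D U u (- k - g A B d) (hi B)"
    using shape K L d D U u ne DU by (auto simp: free_boundary_def valley_peak_shape_def)
  then show ?thesis using shape by blast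
qed

end

section \<open>Holding costs\<close>

definition weighted_cost :: "real \<Rightarrow> (real \<Rightarrow> real) \<Rightarrow> real \<Rightarrow> real \<Rightarrow> real" where
  "weighted_cost lam h a x = (LBINT y=a..x. h y * exp (lam * (y - a)))"

text \<open>After integration by parts this is \<open>(1/\<mu>) \<integral>\<^sub>a\<^sup>x h' y e\<^bsup>\<lambda>(y-a)\<^esup> dy\<close>.  The form below avoids
\<open>h'\<close>, which need not exist at \<open>a\<close>, and is visibly continuous.\<close>

definition threshold :: "real \<Rightarrow> real \<Rightarrow> (real \<Rightarrow> real) \<Rightarrow> real \<Rightarrow> real \<Rightarrow> real" where
  "threshold \<mu> lam h a x = (h x * exp (lam * (x - a)) - lam * weighted_cost lam h a x) / \<mu>"

definition discounted_cost :: "real \<Rightarrow> real \<Rightarrow> (real \<Rightarrow> real) \<Rightarrow> real \<Rightarrow> real \<Rightarrow> real" where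
  "discounted_cost \<mu> lam h a x = lam / \<mu> * exp (- lam * (x - a)) * weighted_cost lam h a x"

lemma weighted_cost_deriv:
  assumes "continuous_on {0..} h" "0 \<le> a" "0 \<le> x"
  shows "(weighted_cost lam h a has_real_derivative h x * exp (lam * (x - a))) (at x within {0..})"
proof -
  define M where "M = max a x + 1"
  have "continuous_on {0..M} (\<lambda>y. h y * exp (lam * (y - a)))"
    by (intro continuous_intros continuous_on_subset[OF assms(1)]) auto
  then have "(weighted_cost lam h a has_vector_derivative h x * exp (lam * (x - a))) (at x within {0..M})"
    unfolding weighted_cost_def [abs_def]
    by (rule interval_integral_FTC2[rotated 2]) (use assms in \<open>auto simp: M_def\<close>)
  moreover have "at x within {0..M} = at x within {0..}"
    by (rule at_within_nhd[of x "{..<M}"]) (auto simp: M_def)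
  ultimately show ?thesis by (simp add: has_real_derivative_iff_has_vector_derivative)
qed

lemma weighted_cost_self: "weighted_cost lam h a a = 0"
  by (simp add: weighted_cost_def)

lemma threshold_deriv:
  assumes "continuous_on {0..} h" "0 \<le> a" "0 < x" "(h has_real_derivative h') (at x)"
  shows "(threshold \<mu> lam h a has_real_derivative h' * exp (lam * (x - a)) / \<mu>) (at x)"
proof -
  have [derivative_intros]:
    "(weighted_cost lam h a has_real_derivative h x * exp (lam * (x - a))) (at x)"
    using weighted_cost_deriv[OF assms(1,2), of x lam] assms(3) by (simp add: at_within_atLeast_pos)
  have "((\<lambda>x. h x * exp (lam * (x - a)) - lam * weighted_cost lam h a x)
      has_real_derivative h' * exp (lam * (x - a))) (at x)"
    by (auto intro!: derivative_eq_intros assms(4))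
  then show ?thesis unfolding threshold_def [abs_def] by (rule DERIV_cdivide)
qed

lemma discounted_cost_deriv:
  assumes "continuous_on {0..} h" "0 \<le> a" "0 \<le> x" "\<mu> \<noteq> 0"
  shows "(discounted_cost \<mu> lam h a has_real_derivative
    lam * exp (- lam * (x - a)) * threshold \<mu> lam h a x) (at x within {0..})"
proof -
  let ?E = "exp (- lam * (x - a))" and ?W = "weighted_cost lam h a"
  have E: "?E * exp (lam * (x - a)) = 1" by (simp flip: exp_add)
  have "(discounted_cost \<mu> lam h a has_real_derivative
      lam / \<mu> * (- lam * ?E) * ?W x + lam / \<mu> * ?E * (h x * exp (lam * (x - a))))
      (at x within {0..})"
    unfolding discounted_cost_def [abs_def]
    by (auto intro!: derivative_eq_intros weighted_cost_deriv assms
        simp: diff_divide_distrib left_diff_distrib right_diff_distrib mult_ac)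
  moreover have "lam / \<mu> * (- lam * ?E) * ?W x + lam / \<mu> * ?E * (h x * exp (lam * (x - a)))
      = lam * ?E * threshold \<mu> lam h a x"
    unfolding threshold_def by (simp add: diff_divide_distrib right_diff_distrib mult_ac)
  ultimately show ?thesis by simp
qed

lemma gAB_eq:
  "gAB \<mu> lam h a A B x = A - B * exp (- lam * (x - a)) - discounted_cost \<mu> lam h a x"
proof -
  have "exp (- lam * (x - y)) = exp (- lam * (x - a)) * exp (lam * (y - a))" for y
    by (simp add: algebra_simps flip: exp_add)
  then have "(\<lambda>y. h y * exp (- lam * (x - y))) =
      (\<lambda>y. exp (- lam * (x - a)) * (h y * exp (lam * (y - a))))"
    by (metis mult.left_commute)
  then show ?thesis
    by (simp add: gAB_def discounted_cost_def weighted_cost_def del: mult_minus_left)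
qed

lemma weighted_cost_cont:
  "continuous_on {0..} h \<Longrightarrow> 0 \<le> a \<Longrightarrow> continuous_on {0..} (weighted_cost lam h a)"
  using weighted_cost_deriv by (auto intro!: DERIV_continuous_on)

lemma threshold_cont:
  "continuous_on {0..} h \<Longrightarrow> 0 \<le> a \<Longrightarrow> continuous_on {0..} (threshold \<mu> lam h a)"
  unfolding threshold_def [abs_def] divide_inverse
  by (intro continuous_intros weighted_cost_cont)

context
  fixes \<mu> lam a :: real and h h' :: "real \<Rightarrow> real"
  assumes mu: "0 < \<mu>" and lam: "0 < lam" and a: "0 \<le> a"
    and h_cont: "continuous_on {0..} h" and h_nonneg: "\<And>x. 0 \<le> x \<Longrightarrow> 0 \<le> h x"
    and h_convex: "convex_on {0..} h" and h_a: "h a = 0"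
    and h_deriv: "\<And>x. 0 < x \<Longrightarrow> x \<noteq> a \<Longrightarrow> (h has_real_derivative h' x) (at x)"
    and h'_neg: "\<And>x. 0 < x \<Longrightarrow> x < a \<Longrightarrow> h' x < 0"
    and h'_pos: "\<And>x. a < x \<Longrightarrow> 0 < h' x"
begin

lemma h_increasing:
  assumes "a \<le> x" "x < y"
  shows "h x < h y"
proof (rule DERIV_pos_imp_increasing_open[OF assms(2)])
  show "\<exists>d. DERIV h z :> d \<and> 0 < d" if "x < z" for z
    using h_deriv[of z] h'_pos[of z] that assms a by auto
qed (use assms a in \<open>auto intro: continuous_on_subset[OF h_cont]\<close>)

text \<open>By convexity and \<open>h a = 0\<close>, \<open>h\<close> lies above the line through \<open>(a, 0)\<close> and \<open>(a + 1, h (a + 1))\<close> from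
\<open>a + 1\<close> on, and this line has positive slope.\<close>

lemma h_at_top: "filterlim h at_top at_top"
proof (rule filterlim_at_top_mono)
  have pos: "0 < h (a + 1)" using h_increasing[of a "a + 1"] h_a by simp
  show "filterlim (\<lambda>x. (x - a) * h (a + 1)) at_top at_top"
    using pos by (intro filterlim_at_top_mult_tendsto_pos[OF tendsto_const])
      (auto intro!: filterlim_tendsto_add_at_top[where f = "\<lambda>_. - a", simplified] filterlim_ident)
  show "\<forall>\<^sub>F x in at_top. (x - a) * h (a + 1) \<le> h x"
    using eventually_ge_at_top[of "a + 1"]
  proof eventually_elim
    case (elim x)
    define t where "t = 1 / (x - a)"
    have t: "0 \<le> t" "t \<le> 1" using elim by (auto simp: t_def)
    have "(1 - t) * a + t * x = a + t * (x - a)" by (simp add: algebra_simps)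
    also have "\<dots> = a + 1" using elim by (simp add: t_def)
    finally have "h (a + 1) \<le> (1 - t) * h a + t * h x"
      using convex_onD[OF h_convex t, of a x] elim a by simp
    then have "(x - a) * h (a + 1) \<le> (x - a) * (t * h x)" using elim h_a by (intro mult_left_mono) auto
    also have "\<dots> = h x" using elim by (simp add: t_def)
    finally show ?case .
  qed
qed

lemma threshold_self: "threshold \<mu> lam h a a = 0"
  by (simp add: threshold_def weighted_cost_self h_a)

lemma threshold_decreasing:
  assumes "0 \<le> x" "x < y" "y \<le> a"
  shows "threshold \<mu> lam h a y < threshold \<mu> lam h a x"
proof (rule DERIV_neg_imp_decreasing_open[OF assms(2)])
  fix z assume "x < z" "z < y"
  then have z: "0 < z" "z < a" using assms by auto
  have "h' z * exp (lam * (z - a)) / \<mu> < 0"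
    using h'_neg[OF z] mu by (simp add: divide_neg_pos mult_neg_pos)
  then show "\<exists>d. DERIV (threshold \<mu> lam h a) z :> d \<and> d < 0"
    using threshold_deriv[OF h_cont a z(1) h_deriv] z by blast
qed (use assms in \<open>auto intro: continuous_on_subset[OF threshold_cont[OF h_cont a]]\<close>)

lemma threshold_increasing:
  assumes "a \<le> x" "x < y"
  shows "threshold \<mu> lam h a x < threshold \<mu> lam h a y"
proof (rule DERIV_pos_imp_increasing_open[OF assms(2)])
  fix z assume "x < z" "z < y"
  then have z: "0 < z" "a < z" using assms a by auto
  have "0 < h' z * exp (lam * (z - a)) / \<mu>" using h'_pos[OF z(2)] mu by simp
  then show "\<exists>d. DERIV (threshold \<mu> lam h a) z :> d \<and> 0 < d"
    using threshold_deriv[OF h_cont a z(1) h_deriv] z by blast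
qed (use assms a in \<open>auto intro: continuous_on_subset[OF threshold_cont[OF h_cont a]]\<close>)

text \<open>The derivative \<open>h' e\<^bsup>\<lambda>(x-a)\<^esup> / \<mu>\<close> of the threshold is at least that of \<open>h / \<mu>\<close> to the right of
\<open>a\<close>, and both functions vanish at \<open>a\<close>.\<close>

lemma threshold_ge:
  assumes "a \<le> x"
  shows "h x / \<mu> \<le> threshold \<mu> lam h a x"
proof -
  have "threshold \<mu> lam h a a - h a / \<mu> \<le> threshold \<mu> lam h a x - h x / \<mu>"
  proof (rule DERIV_nonneg_imp_increasing_open[OF assms])
    fix z assume z: "a < z" "z < x"
    have "((\<lambda>x. threshold \<mu> lam h a x - h x / \<mu>) has_real_derivative
        h' z * exp (lam * (z - a)) / \<mu> - h' z / \<mu>) (at z)"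
      using z a by (intro DERIV_diff DERIV_cdivide threshold_deriv h_cont h_deriv) auto
    moreover have "h' z * 1 \<le> h' z * exp (lam * (z - a))"
      using h'_pos[OF z(1)] lam z by (intro mult_left_mono) auto
    then have "0 \<le> h' z * exp (lam * (z - a)) / \<mu> - h' z / \<mu>"
      using mu by (simp add: divide_right_mono)
    ultimately show "\<exists>d. DERIV (\<lambda>x. threshold \<mu> lam h a x - h x / \<mu>) z :> d \<and> 0 \<le> d" by blast
  next
    show "continuous_on {a..x} (\<lambda>x. threshold \<mu> lam h a x - h x / \<mu>)"
      using a mu by (intro continuous_intros continuous_on_subset[OF threshold_cont[OF h_cont a]]
          continuous_on_subset[OF h_cont]) auto
  qed
  then show ?thesis by (simp add: threshold_self h_a)
qed

lemma threshold_at_top: "filterlim (threshold \<mu> lam h a) at_top at_top"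
proof (rule filterlim_at_top_mono)
  show "filterlim (\<lambda>x. inverse \<mu> * h x) at_top at_top"
    using mu by (intro filterlim_tendsto_pos_mult_at_top[OF tendsto_const] h_at_top) auto
  show "\<forall>\<^sub>F x in at_top. inverse \<mu> * h x \<le> threshold \<mu> lam h a x"
    using eventually_ge_at_top[of a]
    by eventually_elim (use threshold_ge in \<open>simp add: field_simps\<close>)
qed

text \<open>The last unit interval already contributes this much, because \<open>h\<close> is increasing to the right of \<open>a\<close>.  The
inequality in the hypothesis is strict because for \<open>a = 0\<close> and \<open>x = 1\<close> the interval would start at
\<open>0\<close>, where derivatives are one-sided.\<close>

lemma discounted_cost_ge:
  assumes "a + 1 < x"
  shows "lam / \<mu> * exp (- lam) * h (x - 1) \<le> discounted_cost \<mu> lam h a x"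
proof -
  let ?W = "weighted_cost lam h a"
  have W_deriv: "DERIV ?W z :> h z * exp (lam * (z - a))" if "0 < z" for z
    using weighted_cost_deriv[OF h_cont a, of z lam] that by (simp add: at_within_atLeast_pos)
  have "?W a \<le> ?W (x - 1)"
  proof (rule DERIV_nonneg_imp_increasing_open[where f = ?W])
    fix z assume "a < z"
    then show "\<exists>d. DERIV ?W z :> d \<and> 0 \<le> d"
      using W_deriv[of z] h_nonneg[of z] a by (auto intro!: mult_nonneg_nonneg)
qed (use assms a in \<open>auto intro: continuous_on_subset[OF weighted_cost_cont[OF h_cont a]]\<close>)
  moreover have "\<exists>z>x - 1. z < x \<and>
      ?W x - ?W (x - 1) = (x - (x - 1)) * (h z * exp (lam * (z - a)))"
  proof (rule MVT2)
    show "DERIV ?W z :> h z * exp (lam * (z - a))" if "x - 1 \<le> z" "z \<le> x" for z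
      using that assms a by (intro W_deriv) simp
  qed simp
  then obtain z where z: "x - 1 < z" "z < x"
      "?W x - ?W (x - 1) = (x - (x - 1)) * (h z * exp (lam * (z - a)))"
    by blast
  moreover have "h (x - 1) * exp (lam * (x - 1 - a)) \<le> h z * exp (lam * (z - a))"
    using h_increasing[of "x - 1" z] h_nonneg[of z] z assms a lam by (intro mult_mono) auto
  ultimately have "h (x - 1) * exp (lam * (x - 1 - a)) \<le> ?W x"
    by (simp add: weighted_cost_self)
  then have "lam / \<mu> * exp (- lam * (x - a)) * (h (x - 1) * exp (lam * (x - 1 - a)))
      \<le> discounted_cost \<mu> lam h a x"
    unfolding discounted_cost_def using mu lam by (intro mult_left_mono) auto
  moreover have "exp (- lam * (x - a)) * exp (lam * (x - 1 - a)) = exp (- lam)"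
    by (simp add: algebra_simps flip: exp_add)
  ultimately show ?thesis by (simp add: mult_ac)
qed

lemma discounted_cost_at_top: "filterlim (discounted_cost \<mu> lam h a) at_top at_top"
proof (rule filterlim_at_top_mono)
  have "filterlim (\<lambda>x. x - 1 :: real) at_top at_top"
    using filterlim_tendsto_add_at_top[OF tendsto_const[of "-1 :: real"] filterlim_ident] by simp
  then show "filterlim (\<lambda>x. lam / \<mu> * exp (- lam) * h (x - 1)) at_top at_top"
    using mu lam
    by (intro filterlim_tendsto_pos_mult_at_top[OF tendsto_const] filterlim_compose[OF h_at_top]) auto
  show "\<forall>\<^sub>F x in at_top. lam / \<mu> * exp (- lam) * h (x - 1) \<le> discounted_cost \<mu> lam h a x"
    using eventually_gt_at_top[of "a + 1"] by eventually_elim (rule discounted_cost_ge)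
qed

lemma valley_peak_cost: "valley_peak lam a (threshold \<mu> lam h a) (discounted_cost \<mu> lam h a)"
proof
  show "discounted_cost \<mu> lam h a a = 0" by (simp add: discounted_cost_def weighted_cost_self)
  show "(discounted_cost \<mu> lam h a has_real_derivative
      lam * exp (- lam * (x - a)) * threshold \<mu> lam h a x) (at x within {0..})" if "0 \<le> x" for x
    by (rule discounted_cost_deriv[OF h_cont a that]) (use mu in simp)
  show "continuous_on {0..} (threshold \<mu> lam h a)" by (rule threshold_cont[OF h_cont a])
qed (rule lam a threshold_self threshold_at_top discounted_cost_at_top
    | erule (2) threshold_decreasing | erule (1) threshold_increasing)+

end

lemma holding_cost_valley_peak:
  assumes "0 < \<mu>" "0 < lam" "holding_cost h a"
  shows "valley_peak lam a (threshold \<mu> lam h a) (discounted_cost \<mu> lam h a)"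
proof -
  from assms(3) obtain h' where
    "\<forall>x\<in>{0..} - {a}. (h has_real_derivative h' x) (at x within {0..})"
    and h': "\<forall>x. 0 \<le> x \<and> x < a \<longrightarrow> h' x < 0" "\<forall>x>a. 0 < h' x"
    unfolding holding_cost_def by (elim conjE exE)
  then have deriv: "(h has_real_derivative h' x) (at x)" if "0 < x" "x \<noteq> a" for x
    using that by (force simp: at_within_atLeast_pos dest: bspec[of _ _ x])
  have h: "0 \<le> a" "continuous_on {0..} h" "\<forall>x\<ge>0. 0 \<le> h x" "convex_on {0..} h" "h a = 0"
    using assms(3) unfolding holding_cost_def by blast+
  show ?thesis
    by (rule valley_peak_cost[where h' = h']) (use assms(1,2) h h' deriv in simp_all)
qed

theorem theorem7p2:
  fixes \<mu> \<sigma> K L k l lam a :: real and h :: "real \<Rightarrow> real"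
  assumes "\<mu> > 0" and "\<sigma> > 0" and "K > 0" and "L > 0" and "k > 0" and "l > 0"
    and "lam = 2 * \<mu> / \<sigma>\<^sup>2"
    and "holding_cost h a"
  shows "\<exists>A B d D U u \<alpha> x1 x2.
           free_boundary K L k l (gAB \<mu> lam h a A B) d D U u \<alpha> x2 \<and>
           valley_peak_shape (gAB \<mu> lam h a A B) a x1 x2 \<and>
           (\<forall>A' B' d' D' U' u' \<alpha>' x2'.
              free_boundary K L k l (gAB \<mu> lam h a A' B') d' D' U' u' \<alpha>' x2' \<longrightarrow>
              (A', B', d', D', U', u') = (A, B, d, D, U, u))"
proof -
  have "0 < lam" using assms by simp
  then interpret valley_peak lam a "threshold \<mu> lam h a" "discounted_cost \<mu> lam h a"
    using assms by (intro holding_cost_valley_peak)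
  have gAB: "gAB \<mu> lam h a A B = g A B" for A B
    by (rule ext) (simp add: gAB_eq g_def)
  obtain A B d D U u \<alpha> where fb: "free_boundary K L k l (g A B) d D U u \<alpha> (hi B)"
    and shape: "valley_peak_shape (g A B) a (lo B) (hi B)"
    using free_boundary_exists[OF assms(3,4,5,6)] by blast
  show ?thesis unfolding gAB
    using fb shape free_boundary_unique[OF fb _ assms(5,6)] by blast
qed

end
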